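(* For every $\vartheta\in\Theta$ and $t\in[0,T]$, the decoder $$\Phi_\omega^\vartheta(t,\cdot)=\mathcal T_{L,t}^{\mathrm{up},\vartheta}\circ\mathcal T_{L,t}^{\mathrm{low},\vartheta}\circ\cdots\circ\mathcal T_{1,t}^{\mathrm{up},\vartheta}\circ\mathcal T_{1,t}^{\mathrm{low},\vartheta}:\mathbb R^{2n}\to\mathbb R^{2n}$$ is symplectic. Moreover, if $\beta(0)=\beta(T)=0$, then its state component preserves endpoints, in the sense that for all $(y,q)\in\mathbb R^{2n}$ and all $\vartheta\in\Theta$, $$\big(\Phi_\omega^\vartheta(0,y,q)\big)^{(y)}=y,\qquad \big(\Phi_\omega^\vartheta(T,y,q)\big)^{(y)}=y.$$
   Context: Let $N,d_x,L\ge 1$ be integers, $n=Nd_x$, $T>0$, and let $\Theta$ be the set of problem instances (parameters). Points of $\mathbb R^{2n}$ are written $(y,q)$ with $y,q\in\mathbb R^n$; for a point $w=(w_1,w_2)\in\mathbb R^n\times\mathbb R^n$, $w^{(y)}:=w_1$ denotes its state component (first $n$ coordinates). Let $$J=\begin{pmatrix}0&I_n\\-I_n&0\end{pmatrix}\in\mathbb R^{2n\times 2n}.$$ A differentiable map $\Phi:\mathbb R^{2n}\to\mathbb R^{2n}$ is called symplectic if $(\nabla\Phi(z))^\top J\,\nabla\Phi(z)=J$ for all $z\in\mathbb R^{2n}$, where $\nabla\Phi(z)$ is the Jacobian matrix of $\Phi$ at $z$. For each layer $\ell=1,\dots,L$ there are given functions $K_\ell:\Theta\to\mathbb R^{n\times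 n}$, $b_\ell:\Theta\to\mathbb R^n$, $a_\ell:\Theta\times[0,T]\to\mathbb R^n$ (in the application, outputs of neural networks whose trainable weights are collectively denoted $\omega$; here they may be regarded as arbitrary functions). Define, for $z\in\mathbb R^n$ and $t\in[0,T]$, the scalar potential $$\Psi_\ell^\vartheta(z,t)=\tfrac12\,(K_\ell(\vartheta)z+b_\ell(\vartheta))^\top\,\mathrm{Diag}(a_\ell(\vartheta,t))\,(K_\ell(\vartheta)z+b_\ell(\vartheta)),$$ where $\mathrm{Diag}(a)$ is the diagonal matrix with diagonal entries given by the vector $a$, and its gradient $$\sigma_\ell^\vartheta(z,t)=\nabla_z\Psi_\ell^\vartheta(z,t)=K_\ell(\vartheta)^\top\big(a_\ell(\vartheta,t)\odot(K_\ell(\vartheta)z+b_\ell(\vartheta))\big)\in\mathbb R^n,$$ where $\odot$ is the entrywise product. Let $\beta:[0,T]\to\mathbb R$ be a scalar function (the choice used for fixed-endpoint problems is $\beta(t)=t(T-t)$). The lower and upper shears are the maps $\mathbb R^{2n}\to\mathbb R^{2n}$ $$\mathcal T^{\mathrm{low},\vartheta}_{\ell,t}(y,q)=\big(y,\; q+\sigma_\ell^\vartheta(y,t)\big),\qquad \mathcal T^{\mathrm{up},\vartheta}_{\ell,t}(y,q)=\big(y+\beta(t)\,\sigma_\ell^\vartheta(q,t),\; q\big).$$ *)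

theory Defs
  imports "HOL-Analysis.Analysis"
begin

text \<open>
  A finite index type \<open>'n\<close> with \<open>n\<close> elements indexes the coordinates of \<open>n\<close>-space.
  Then \<open>2n\<close>-space is \<open>real ^ ('n + 'n)\<close>: the indices \<open>Inl i\<close> carry the state component \<open>y\<close>
  and the indices \<open>Inr i\<close> the component \<open>q\<close>.
\<close>

definition join :: "real ^ 'n::finite \<Rightarrow> real ^ 'n \<Rightarrow> real ^ ('n + 'n)" where
  "join y q = (\<chi> i. case i of Inl j \<Rightarrow> y $ j | Inr j \<Rightarrow> q $ j)"

definition state_part :: "real ^ ('n::finite + 'n) \<Rightarrow> real ^ 'n" where
  "state_part w = (\<chi> i. w $ Inl i)"

definition costate_part :: "real ^ ('n::finite + 'n) \<Rightarrow> real ^ 'n" where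
  "costate_part w = (\<chi> i. w $ Inr i)"

lemma state_part_join [simp]: "state_part (join y q) = y"
  by (simp add: state_part_def join_def vec_eq_iff)

lemma costate_part_join [simp]: "costate_part (join y q) = q"
  by (simp add: costate_part_def join_def vec_eq_iff)

lemma join_parts [simp]: "join (state_part w) (costate_part w) = w"
  by (simp add: state_part_def costate_part_def join_def vec_eq_iff split: sum.split)

definition J_mat :: "real ^ ('n::finite + 'n) ^ ('n + 'n)" where
  "J_mat = (\<chi> i j. case (i, j) of
      (Inl k, Inr l) \<Rightarrow> if k = l then 1 else 0
    | (Inr k, Inl l) \<Rightarrow> if k = l then - 1 else 0
    | _ \<Rightarrow> 0)"

definition symplectic :: "(real ^ ('n::finite + 'n) \<Rightarrow> real ^ ('n + 'n)) \<Rightarrow> bool" where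
  "symplectic F \<longleftrightarrow>
     (\<forall>z. F differentiable (at z)) \<and>
     (\<forall>z. transpose (jacobian F (at z)) ** J_mat ** jacobian F (at z) = J_mat)"

definition Diag :: "real ^ 'n \<Rightarrow> real ^ 'n ^ 'n" where
  "Diag a = (\<chi> i j. if i = j then a $ i else 0)"

definition gradient :: "('a::real_inner \<Rightarrow> real) \<Rightarrow> 'a \<Rightarrow> 'a" where
  "gradient f z = (THE g. GDERIV f z :> g)"

text \<open>
  Below \<open>K\<close>, \<open>b\<close>, \<open>a\<close> are families indexed by the layer \<open>l\<close>, \<open>p\<close> is the problem instance
  and \<open>t\<close> the time.
\<close>

definition Psi ::
  "(nat \<Rightarrow> 'p \<Rightarrow> real ^ 'n ^ 'n) \<Rightarrow> (nat \<Rightarrow> 'p \<Rightarrow> real ^ 'n) \<Rightarrow> (nat \<Rightarrow> 'p \<Rightarrow> real \<Rightarrow> real ^ 'n)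
   \<Rightarrow> nat \<Rightarrow> 'p \<Rightarrow> real ^ 'n \<Rightarrow> real \<Rightarrow> real" where
  "Psi K b a l p z t =
     1 / 2 * ((K l p *v z + b l p) \<bullet> (Diag (a l p t) *v (K l p *v z + b l p)))"

definition sigma_map ::
  "(nat \<Rightarrow> 'p \<Rightarrow> real ^ 'n ^ 'n) \<Rightarrow> (nat \<Rightarrow> 'p \<Rightarrow> real ^ 'n) \<Rightarrow> (nat \<Rightarrow> 'p \<Rightarrow> real \<Rightarrow> real ^ 'n)
   \<Rightarrow> nat \<Rightarrow> 'p \<Rightarrow> real ^ 'n \<Rightarrow> real \<Rightarrow> real ^ 'n" where
  "sigma_map K b a l p z t = gradient (\<lambda>x. Psi K b a l p x t) z"

definition T_low ::
  "(nat \<Rightarrow> 'p \<Rightarrow> real ^ 'n ^ 'n) \<Rightarrow> (nat \<Rightarrow> 'p \<Rightarrow> real ^ 'n) \<Rightarrow> (nat \<Rightarrow> 'p \<Rightarrow> real \<Rightarrow> real ^ 'n)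
   \<Rightarrow> nat \<Rightarrow> 'p \<Rightarrow> real \<Rightarrow> real ^ ('n + 'n) \<Rightarrow> real ^ ('n + 'n)" where
  "T_low K b a l p t w =
     join (state_part w) (costate_part w + sigma_map K b a l p (state_part w) t)"

definition T_up ::
  "(nat \<Rightarrow> 'p \<Rightarrow> real ^ 'n ^ 'n) \<Rightarrow> (nat \<Rightarrow> 'p \<Rightarrow> real ^ 'n) \<Rightarrow> (nat \<Rightarrow> 'p \<Rightarrow> real \<Rightarrow> real ^ 'n)
   \<Rightarrow> (real \<Rightarrow> real) \<Rightarrow> nat \<Rightarrow> 'p \<Rightarrow> real \<Rightarrow> real ^ ('n + 'n) \<Rightarrow> real ^ ('n + 'n)" where
  "T_up K b a \<beta> l p t w =
     join (state_part w + \<beta> t *\<^sub>R sigma_map K b a l p (costate_part w) t) (costate_part w)"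

primrec decoder ::
  "(nat \<Rightarrow> 'p \<Rightarrow> real ^ 'n ^ 'n) \<Rightarrow> (nat \<Rightarrow> 'p \<Rightarrow> real ^ 'n) \<Rightarrow> (nat \<Rightarrow> 'p \<Rightarrow> real \<Rightarrow> real ^ 'n)
   \<Rightarrow> (real \<Rightarrow> real) \<Rightarrow> nat \<Rightarrow> 'p \<Rightarrow> real \<Rightarrow> real ^ ('n + 'n) \<Rightarrow> real ^ ('n + 'n)" where
  "decoder K b a \<beta> 0 p t = id"
| "decoder K b a \<beta> (Suc l) p t =
     T_up K b a \<beta> (Suc l) p t \<circ> T_low K b a (Suc l) p t \<circ> decoder K b a \<beta> l p t"

lemma gradient_eq:
  assumes "GDERIV f z :> g"
  shows "gradient f z = g"
  unfolding gradient_def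
proof (rule the_equality[where P = "\<lambda>g. GDERIV f z :> g", OF assms])
  fix h assume "GDERIV f z :> h"
  with assms have "(\<lambda>x. x \<bullet> h) = (\<lambda>x. x \<bullet> g)"
    unfolding gderiv_def by (rule has_derivative_unique[rotated])
  then have "\<forall>x. x \<bullet> h = x \<bullet> g"
    by (simp add: fun_eq_iff)
  then show "h = g"
    by (simp only: vector_eq_ldot vector_eq_rdot)
qed

lemma Diag_mult_vec: "Diag a *v x = a * x"
proof -
  have "(if i = j then a $ i else 0) * x $ j = (if i = j then a $ i * x $ i else 0)" for i j
    by simp
  then show ?thesis
    by (simp add: Diag_def matrix_vector_mult_def vec_eq_iff)
qed

lemma GDERIV_Psi:
  fixes K :: "nat \<Rightarrow> 'p \<Rightarrow> real ^ 'n ^ 'n"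
  shows "GDERIV (\<lambda>x. Psi K b a l p x t) z :>
           transpose (K l p) *v (a l p t * (K l p *v z + b l p))"
proof -
  let ?u = "\<lambda>x. K l p *v x + b l p"
  have u: "(?u has_derivative (\<lambda>h. K l p *v h)) (at z)"
    by (intro has_derivative_add_const bounded_linear_imp_has_derivative matrix_vector_mul_bounded_linear)
  have v: "((\<lambda>x. Diag (a l p t) *v ?u x) has_derivative
             (\<lambda>h. Diag (a l p t) *v (K l p *v h))) (at z)"
    by (intro bounded_linear.has_derivative[OF matrix_vector_mul_bounded_linear] u)
  have sym: "x \<bullet> (Diag c *v y) = y \<bullet> (Diag c *v x)" for x y c :: "real ^ 'n"
    by (simp add: Diag_mult_vec inner_vec_def mult_ac)
  have "((\<lambda>x. Psi K b a l p x t) has_derivative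
          (\<lambda>h. (K l p *v h) \<bullet> (Diag (a l p t) *v ?u z))) (at z)"
    unfolding Psi_def
    by (rule has_derivative_eq_rhs[OF has_derivative_mult_right[OF has_derivative_inner[OF u v]]])
       (simp add: sym[of "?u z"])
  moreover have "(K l p *v h) \<bullet> w = h \<bullet> (transpose (K l p) *v w)" for h w
    by (simp add: dot_lmul_matrix inner_commute[of _ w] inner_commute[of h])
  ultimately show ?thesis
    unfolding gderiv_def Diag_mult_vec by simp
qed

lemma sigma_map_eq:
  "sigma_map K b a l p z t = transpose (K l p) *v (a l p t * (K l p *v z + b l p))"
  unfolding sigma_map_def by (rule gradient_eq[OF GDERIV_Psi])

end

theory Submission
  imports Defs
begin

text \<open>
  A linear map preserves the matrix \<open>J\<close> exactly when it preserves the bilinear form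
  \<open>\<omega>(u, v) = u\<^sub>y \<bullet> v\<^sub>q - u\<^sub>q \<bullet> v\<^sub>y\<close>. Read this way, symplecticity says that the derivative at
  every point preserves \<open>\<omega>\<close>, so by the chain rule it passes to compositions
  (\<open>symplectic_compose\<close>), and it suffices to treat a single shear.

  The derivative of a shear sends \<open>(u\<^sub>y, u\<^sub>q)\<close> to \<open>(u\<^sub>y, u\<^sub>q + S u\<^sub>y)\<close>, or to the mirror image of
  this, where \<open>S\<close> is the derivative of the shearing map. It changes \<open>\<omega>(u, v)\<close> by
  \<open>u\<^sub>y \<bullet> S v\<^sub>y - S u\<^sub>y \<bullet> v\<^sub>y\<close>, which vanishes when \<open>S\<close> is self-adjoint. Here the shearing maps
  are multiples of gradients of the potentials, so \<open>S\<close> is a multiple of the Hessian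
  \<open>K\<^sup>T Diag(a) K\<close>, which is symmetric. The scalar \<open>\<beta> t\<close> does not disturb this, since it is
  constant in the spatial variables.

  For the endpoints: a lower shear never moves the state component, and an upper shear at a
  time \<open>t\<close> with \<open>\<beta> t = 0\<close> is the identity.
\<close>

definition symplectic_form :: "real ^ ('n::finite + 'n) \<Rightarrow> real ^ ('n + 'n) \<Rightarrow> real" where
  "symplectic_form u v = state_part u \<bullet> costate_part v - costate_part u \<bullet> state_part v"

lemma inner_transpose_mult_vec:
  fixes A :: "real ^ 'n ^ 'm"
  shows "u \<bullet> (transpose A *v w) = (A *v u) \<bullet> w"
  by (metis dot_lmul_matrix inner_commute transpose_matrix_vector)

lemma inner_J_mat:
  fixes u v :: "real ^ ('n::finite + 'n)"
  shows "u \<bullet> (J_mat *v v) = symplectic_form u v"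
proof -
  have sum_split: "sum f UNIV = (\<Sum>i\<in>UNIV. f (Inl i)) + (\<Sum>i\<in>UNIV. f (Inr i))"
    for f :: "'n + 'n \<Rightarrow> real"
    by (simp add: UNIV_Plus_UNIV[symmetric] sum.Plus del: UNIV_Plus_UNIV)
  have delta: "(if i = j then c else 0) * x = (if i = j then c * x else 0)"
    for i j :: 'n and c x :: real
    by simp
  have "(J_mat *v v) $ Inl i = v $ Inr i" and "(J_mat *v v) $ Inr i = - (v $ Inl i)" for i :: 'n
    by (simp_all add: matrix_vector_mult_def J_mat_def sum_split delta)
  then show ?thesis
    by (simp add: inner_vec_def sum_split symplectic_form_def state_part_def costate_part_def
        sum_negf)
qed

text \<open>
  Passing from matrices to the form avoids all block computations with Jacobians: a matrix is
  determined by its bilinear form, and \<open>A\<^sup>T J A\<close> is the matrix of the pullback of \<open>\<omega>\<close> by \<open>A\<close>.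
\<close>

lemma preserves_J_mat_iff:
  "transpose A ** J_mat ** A = J_mat \<longleftrightarrow>
     (\<forall>u v. symplectic_form (A *v u) (A *v v) = symplectic_form u v)"
proof -
  have "u \<bullet> ((transpose A ** J_mat ** A) *v v) = symplectic_form (A *v u) (A *v v)" for u v
    by (simp only: inner_J_mat[symmetric] matrix_vector_mul_assoc[symmetric]
        inner_transpose_mult_vec)
  then show ?thesis
    by (metis inner_J_mat matrix_eq vector_eq_ldot)
qed

text \<open>
  Derivatives are unique, so any convenient closed form of the derivative may stand in for the
  Jacobian.
\<close>

lemma symplecticI:
  assumes deriv: "\<And>z. (F has_derivative F' z) (at z)"
    and form: "\<And>z u v. symplectic_form (F' z u) (F' z v) = symplectic_form u v"
  shows "symplectic F"
  unfolding symplectic_def preserves_J_mat_iff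
proof (intro conjI allI)
  fix z u v
  show diff: "F differentiable (at z)"
    using deriv by (rule differentiableI)
  have "(\<lambda>h. jacobian F (at z) *v h) = F' z"
    using jacobian_works[THEN iffD1, OF diff] deriv by (rule has_derivative_unique)
  then have "jacobian F (at z) *v h = F' z h" for h
    by (rule fun_cong)
  then show "symplectic_form (jacobian F (at z) *v u) (jacobian F (at z) *v v)
      = symplectic_form u v"
    by (simp add: form)
qed

lemma symplecticD:
  assumes "symplectic F"
  shows "(F has_derivative (\<lambda>h. jacobian F (at z) *v h)) (at z)"
    and "symplectic_form (jacobian F (at z) *v u) (jacobian F (at z) *v v) = symplectic_form u v"
  using assms by (simp_all add: symplectic_def preserves_J_mat_iff jacobian_works)

lemma symplectic_id: "symplectic id"
  by (rule symplecticI[OF has_derivative_id]) simp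

lemma symplectic_compose:
  assumes G: "symplectic G" and F: "symplectic F"
  shows "symplectic (G \<circ> F)"
  by (rule symplecticI[OF diff_chain_at[OF symplecticD(1)[OF F] symplecticD(1)[OF G]]])
     (simp add: symplecticD(2)[OF F] symplecticD(2)[OF G])

lemma bounded_linear_state_part: "bounded_linear state_part"
  by (intro linear_conv_bounded_linear[THEN iffD1] linearI)
     (simp_all add: state_part_def vec_eq_iff)

lemma bounded_linear_costate_part: "bounded_linear costate_part"
  by (intro linear_conv_bounded_linear[THEN iffD1] linearI)
     (simp_all add: costate_part_def vec_eq_iff)

lemma has_derivative_join:
  assumes "(f has_derivative f') (at z)" and "(g has_derivative g') (at z)"
  shows "((\<lambda>w. join (f w) (g w)) has_derivative (\<lambda>h. join (f' h) (g' h))) (at z)"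
proof -
  have "bounded_linear (\<lambda>x. join (fst x) (snd x))"
    by (intro linear_conv_bounded_linear[THEN iffD1] linearI)
       (simp_all add: join_def vec_eq_iff split: sum.split)
  from bounded_linear.has_derivative[OF this has_derivative_Pair[OF assms]]
  show ?thesis by simp
qed

lemma has_derivative_comp_bounded_linear:
  assumes "bounded_linear p" and "\<And>z. (s has_derivative s' z) (at z)"
  shows "((\<lambda>w. s (p w)) has_derivative (\<lambda>h. s' (p z) (p h))) (at z)"
  using diff_chain_at[OF bounded_linear_imp_has_derivative[OF assms(1)] assms(2)]
  by (simp add: o_def)

text \<open>
  With \<open>S\<close> the derivative of \<open>s\<close> at the base point, the form of the two image vectors exceeds
  \<open>\<omega>(u, v)\<close> by \<open>u\<^sub>y \<bullet> S v\<^sub>y - S u\<^sub>y \<bullet> v\<^sub>y\<close> for a lower shear and by \<open>S u\<^sub>q \<bullet> v\<^sub>q - u\<^sub>q \<bullet> S v\<^sub>q\<close> for an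
  upper one; the cross terms between \<open>S\<close>-parts are absent because only one component is moved.
\<close>

lemma symplectic_lower_shear:
  assumes deriv: "\<And>z. (s has_derivative s' z) (at z)"
    and self_adjoint: "\<And>z x y. s' z x \<bullet> y = x \<bullet> s' z y"
  shows "symplectic (\<lambda>w. join (state_part w) (costate_part w + s (state_part w)))"
  by (rule symplecticI[OF has_derivative_join[OF
          bounded_linear_imp_has_derivative[OF bounded_linear_state_part]
          has_derivative_add[OF bounded_linear_imp_has_derivative[OF bounded_linear_costate_part]
            has_derivative_comp_bounded_linear[OF bounded_linear_state_part deriv]]]])
     (simp add: symplectic_form_def inner_add self_adjoint)

lemma symplectic_upper_shear:
  assumes deriv: "\<And>z. (s has_derivative s' z) (at z)"
    and self_adjoint: "\<And>z x y. s' z x \<bullet> y = x \<bullet> s' z y"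
  shows "symplectic (\<lambda>w. join (state_part w + s (costate_part w)) (costate_part w))"
  by (rule symplecticI[OF has_derivative_join[OF
          has_derivative_add[OF bounded_linear_imp_has_derivative[OF bounded_linear_state_part]
            has_derivative_comp_bounded_linear[OF bounded_linear_costate_part deriv]]
          bounded_linear_imp_has_derivative[OF bounded_linear_costate_part]]])
     (simp add: symplectic_form_def inner_add self_adjoint)

text \<open>
  The derivative of \<open>sigma_map\<close> is the Hessian \<open>K\<^sup>T Diag(a) K\<close> of the potential; since the
  potential is quadratic, it does not depend on the base point.
\<close>

lemma has_derivative_sigma_map:
  "((\<lambda>z. sigma_map K b a l p z t) has_derivative
     (\<lambda>h. transpose (K l p) *v (Diag (a l p t) *v (K l p *v h)))) (at z)"
  unfolding sigma_map_eq Diag_mult_vec[symmetric]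
  by (intro bounded_linear.has_derivative[OF matrix_vector_mul_bounded_linear]
      has_derivative_add_const bounded_linear_imp_has_derivative matrix_vector_mul_bounded_linear)

lemma Hessian_self_adjoint:
  fixes A :: "real ^ 'n ^ 'm"
  shows "(transpose A *v (Diag c *v (A *v x))) \<bullet> y = x \<bullet> (transpose A *v (Diag c *v (A *v y)))"
proof -
  have "(transpose A *v (Diag c *v (A *v x))) \<bullet> y = (A *v y) \<bullet> (Diag c *v (A *v x))"
    by (simp only: inner_transpose_mult_vec inner_commute[of _ y])
  also have "\<dots> = (A *v x) \<bullet> (Diag c *v (A *v y))"
    by (simp add: Diag_mult_vec inner_vec_def mult_ac)
  finally show ?thesis
    by (simp only: inner_transpose_mult_vec)
qed

lemma symplectic_T_low: "symplectic (T_low K b a l p t)"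
  using symplectic_lower_shear[OF has_derivative_sigma_map Hessian_self_adjoint]
  by (simp add: T_low_def[abs_def])

lemma symplectic_T_up: "symplectic (T_up K b a \<beta> l p t)"
proof -
  have "symplectic (\<lambda>w. join
      (state_part w + \<beta> t *\<^sub>R sigma_map K b a l p (costate_part w) t) (costate_part w))"
    by (rule symplectic_upper_shear[where s = "\<lambda>z. \<beta> t *\<^sub>R sigma_map K b a l p z t",
          OF has_derivative_scaleR_right[OF has_derivative_sigma_map]])
       (simp only: inner_scaleR_left inner_scaleR_right Hessian_self_adjoint)
  then show ?thesis
    by (simp add: T_up_def[abs_def])
qed

lemma symplectic_decoder: "symplectic (decoder K b a \<beta> L p t)"
  by (induction L)
     (simp_all only: decoder.simps symplectic_id symplectic_compose symplectic_T_low
       symplectic_T_up)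

lemma state_part_decoder:
  assumes "\<beta> t = 0"
  shows "state_part (decoder K b a \<beta> L p t w) = state_part w"
  by (induction L) (simp_all add: T_up_def T_low_def assms)

theorem proposition2:
  fixes N d\<^sub>x L :: nat
    and T :: real
    and \<Theta> :: "'p set"
    and K :: "nat \<Rightarrow> 'p \<Rightarrow> real ^ 'n ^ 'n"
    and b :: "nat \<Rightarrow> 'p \<Rightarrow> real ^ 'n"
    and a :: "nat \<Rightarrow> 'p \<Rightarrow> real \<Rightarrow> real ^ 'n"
    and \<beta> :: "real \<Rightarrow> real"
  assumes "N \<ge> 1" and "d\<^sub>x \<ge> 1" and "L \<ge> 1"
    and "CARD('n) = N * d\<^sub>x"
    and "T > 0"
  shows "(\<forall>\<theta>\<in>\<Theta>. \<forall>t\<in>{0..T}. symplectic (decoder K b a \<beta> L \<theta> t)) \<and>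
         (\<beta> 0 = 0 \<and> \<beta> T = 0 \<longrightarrow>
           (\<forall>\<theta>\<in>\<Theta>. \<forall>y q.
              state_part (decoder K b a \<beta> L \<theta> 0 (join y q)) = y \<and>
              state_part (decoder K b a \<beta> L \<theta> T (join y q)) = y))"
  by (simp add: symplectic_decoder state_part_decoder)

end
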